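(* Let $(X,\mathcal{B}[X],P_1)$ and $(Y,\mathcal{B}[Y],P_2)$ be two Borel probability spaces such that both $X$ and $Y$ are compact metric spaces. Then every $(P_1\otimes^{\sigma}P_2)$-continuity set is an element of $(\mathcal{B}[X]\otimes\mathcal{B}[Y])^{c}$.
   Context: $\mathcal{B}[X]$ denotes the Borel $\sigma$-algebra of $X$. All probability measures $P_1,P_2$ here are standard and countably additive. $\mathcal{B}[X]\otimes\mathcal{B}[Y]$ denotes the algebra (closed under finite, not countable, unions) of subsets of $X\times Y$ generated by the rectangles $A_1\times A_2$ with $A_1\in\mathcal{B}[X]$, $A_2\in\mathcal{B}[Y]$, and $P_1\otimes P_2$ is the finitely additive product probability measure on it, with $(P_1\otimes P_2)(A_1\times A_2)=P_1(A_1)P_2(A_2)$. $\mathcal{B}[X]\otimes^{\sigma}\mathcal{B}[Y]$ denotes the $\sigma$-algebra generated by such rectangles, and $P_1\otimes^{\sigma}P_2$ is the usual countably additive product measure on it. A $(P_1\otimes^{\sigma}P_2)$-continuity set is a set $E\in\mathcal{B}[X]\otimes^{\sigma}\mathcal{B}[Y]$ with $(P_1\otimes^{\sigma}P_2)(\partial E)=0$, where $\partial E$ is the topological boundary of $E$ in $X\times Y$. For a finitely additive probability space $(Z,\mathcal{F},\mu)$, the completion $\mathcal{F}^{c}$ is the collection of all sets $A\subset Z$ such that for every $\epsilon>0$ there exist $A_1,A_2\in\mathcal{F}$ with $A_1\subset A\subset A_2$ and $\mu(A_2\setminus A_1)<\epsilon$. Here $(\mathcal{B}[X]\otimes\mathcal{B}[Y])^{c}$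 is the completion with respect to $P_1\otimes P_2$. *)

theory Defs
  imports "HOL-Probability.Probability"
begin

text \<open>
  Finitely additive probability spaces. Values are real; \<open>\<mu>\<close> is only constrained on the algebra \<open>F\<close>.
\<close>

definition fa_prob_space :: "'a set \<Rightarrow> 'a set set \<Rightarrow> ('a set \<Rightarrow> real) \<Rightarrow> bool" where
  "fa_prob_space \<Omega> F \<mu> \<longleftrightarrow>
     algebra \<Omega> F \<and> (\<forall>A\<in>F. 0 \<le> \<mu> A) \<and> additive F \<mu> \<and> \<mu> \<Omega> = 1"

definition fa_completion :: "'a set \<Rightarrow> 'a set set \<Rightarrow> ('a set \<Rightarrow> real) \<Rightarrow> 'a set set" where
  "fa_completion \<Omega> F \<mu> =
     {A. A \<subseteq> \<Omega> \<and> (\<forall>\<epsilon>>0. \<exists>A1\<in>F. \<exists>A2\<in>F. A1 \<subseteq> A \<and> A \<subseteq> A2 \<and> \<mu> (A2 - A1) < \<epsilon>)}"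

definition rectangles :: "'a measure \<Rightarrow> 'b measure \<Rightarrow> ('a \<times> 'b) set set" where
  "rectangles P1 P2 = {A1 \<times> A2 | A1 A2. A1 \<in> sets P1 \<and> A2 \<in> sets P2}"

text \<open>The smallest algebra (not \<open>\<sigma>\<close>-algebra) on the product that contains all rectangles.\<close>

definition product_algebra :: "'a measure \<Rightarrow> 'b measure \<Rightarrow> ('a \<times> 'b) set set" where
  "product_algebra P1 P2 = (algebra (space P1 \<times> space P2)) hull (rectangles P1 P2)"

definition is_fa_product :: "'a measure \<Rightarrow> 'b measure \<Rightarrow> (('a \<times> 'b) set \<Rightarrow> real) \<Rightarrow> bool" where
  "is_fa_product P1 P2 \<mu> \<longleftrightarrow>
     fa_prob_space (space P1 \<times> space P2) (product_algebra P1 P2) \<mu> \<and>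
     (\<forall>A1\<in>sets P1. \<forall>A2\<in>sets P2. \<mu> (A1 \<times> A2) = measure P1 A1 * measure P2 A2)"

text \<open>
  The finitely additive product. Outside the product algebra the value is fixed to be 0, so that
  the description is unique; lemma \<open>ex1_fa_product\<close> shows that it is proper for probability spaces.
\<close>

definition fa_product :: "'a measure \<Rightarrow> 'b measure \<Rightarrow> ('a \<times> 'b) set \<Rightarrow> real" where
  "fa_product P1 P2 =
     (THE \<mu>. is_fa_product P1 P2 \<mu> \<and> (\<forall>A. A \<notin> product_algebra P1 P2 \<longrightarrow> \<mu> A = 0))"

text \<open>
  Since \<open>emeasure\<close> is 0 on non-measurable sets, the second condition says what it should only if
  the frontier is measurable. This is automatic for the product of Borel measures on compact
  metric spaces, where closed sets of the product space are product measurable.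
\<close>

definition continuity_set :: "'a::topological_space measure \<Rightarrow> 'a set \<Rightarrow> bool" where
  "continuity_set M E \<longleftrightarrow> E \<in> sets M \<and> emeasure M (frontier E) = 0"

lemma rectangles_subset: "rectangles P1 P2 \<subseteq> Pow (space P1 \<times> space P2)"
  unfolding rectangles_def by (auto dest: sets.sets_into_space)

lemma algebra_product_algebra: "algebra (space P1 \<times> space P2) (product_algebra P1 P2)"
proof -
  let ?\<Omega> = "space P1 \<times> space P2"
  have mem: "A \<in> product_algebra P1 P2 \<longleftrightarrow> (\<forall>F. algebra ?\<Omega> F \<and> rectangles P1 P2 \<subseteq> F \<longrightarrow> A \<in> F)" for A
    unfolding product_algebra_def hull_def by blast
  have "product_algebra P1 P2 \<subseteq> Pow ?\<Omega>"
    unfolding product_algebra_def by (intro hull_minimal rectangles_subset algebra_Pow)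
  moreover have "{} \<in> product_algebra P1 P2"
    by (simp add: mem algebra_iff_Un)
  moreover have "?\<Omega> - a \<in> product_algebra P1 P2" if "a \<in> product_algebra P1 P2" for a
    using that by (simp add: mem algebra_iff_Un)
  moreover have "a \<union> b \<in> product_algebra P1 P2"
    if "a \<in> product_algebra P1 P2" "b \<in> product_algebra P1 P2" for a b
    using that by (simp add: mem algebra_iff_Un)
  ultimately show ?thesis
    by (simp add: algebra_iff_Un)
qed

lemma product_algebra_subset_sets: "product_algebra P1 P2 \<subseteq> sets (P1 \<Otimes>\<^sub>M P2)"
proof -
  have "algebra (space P1 \<times> space P2) (sets (P1 \<Otimes>\<^sub>M P2))"
    using sets.algebra_axioms[of "P1 \<Otimes>\<^sub>M P2"] by (simp add: space_pair_measure)
  then show ?thesis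
    unfolding product_algebra_def by (intro hull_minimal) (auto simp: rectangles_def)
qed

lemma semiring_rectangles: "semiring_of_sets (space P1 \<times> space P2) (rectangles P1 P2)"
proof
  show "rectangles P1 P2 \<subseteq> Pow (space P1 \<times> space P2)"
    by (rule rectangles_subset)
  show "{} \<in> rectangles P1 P2"
    by (auto simp: rectangles_def)
  fix a b assume "a \<in> rectangles P1 P2" "b \<in> rectangles P1 P2"
  then obtain A B C D where s: "A \<in> sets P1" "B \<in> sets P2" "C \<in> sets P1" "D \<in> sets P2"
    and ab: "a = A \<times> B" "b = C \<times> D"
    by (auto simp: rectangles_def)
  have "a \<inter> b = (A \<inter> C) \<times> (B \<inter> D)"
    by (auto simp: ab)
  then show "a \<inter> b \<in> rectangles P1 P2"
    unfolding rectangles_def using s by blast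
  let ?c = "{(A - C) \<times> B, (A \<inter> C) \<times> (B - D)}"
  have "(A - C) \<times> B \<in> rectangles P1 P2" "(A \<inter> C) \<times> (B - D) \<in> rectangles P1 P2"
    unfolding rectangles_def using s by blast+
  moreover have "a - b = \<Union>?c" "disjoint ?c"
    by (auto simp: ab disjoint_def)
  ultimately show "\<exists>c\<subseteq>rectangles P1 P2. finite c \<and> disjoint c \<and> a - b = \<Union>c"
    by (intro exI[of _ ?c]) simp
qed

lemma product_algebra_decomp:
  assumes "A \<in> product_algebra P1 P2"
  obtains C where "finite C" "disjoint C" "C \<subseteq> rectangles P1 P2" "A = \<Union>C"
proof -
  interpret semiring_of_sets "space P1 \<times> space P2" "rectangles P1 P2"
    by (rule semiring_rectangles)
  interpret g: ring_of_sets "space P1 \<times> space P2" generated_ring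
    by (rule generating_ring)
  have "space P1 \<times> space P2 \<in> rectangles P1 P2"
    by (auto simp: rectangles_def)
  then have \<Omega>: "space P1 \<times> space P2 \<in> generated_ring"
    by (rule generated_ringI_Basic)
  have "algebra (space P1 \<times> space P2) generated_ring"
    using g.ring_of_sets_axioms \<Omega> by (simp add: algebra_def algebra_axioms_def)
  then have "product_algebra P1 P2 \<subseteq> generated_ring"
    unfolding product_algebra_def by (intro hull_minimal) (auto intro: generated_ringI_Basic)
  with assms have "A \<in> generated_ring" by blast
  then show thesis
    by (auto elim!: generated_ringE intro: that)
qed

lemma is_fa_product_pair_measure:
  assumes "prob_space P1" "prob_space P2"
  shows "is_fa_product P1 P2 (measure (P1 \<Otimes>\<^sub>M P2))"
proof -
  interpret P1: prob_space P1 by fact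
  interpret P2: prob_space P2 by fact
  interpret pair_prob_space P1 P2 ..
  have "additive (product_algebra P1 P2) (measure (P1 \<Otimes>\<^sub>M P2))"
    unfolding additive_def using product_algebra_subset_sets[of P1 P2]
    by (auto intro!: finite_measure_Union)
  moreover have "measure (P1 \<Otimes>\<^sub>M P2) (A \<times> B) = measure P1 A * measure P2 B"
    if "A \<in> sets P1" "B \<in> sets P2" for A B
    using P2.emeasure_pair_measure_Times[OF that] by (simp add: measure_def enn2real_mult)
  moreover have "measure (P1 \<Otimes>\<^sub>M P2) (space P1 \<times> space P2) = 1"
    using prob_space by (simp add: space_pair_measure)
  ultimately show ?thesis
    using algebra_product_algebra[of P1 P2] by (simp add: is_fa_product_def fa_prob_space_def)
qed

lemma is_fa_product_unique:
  assumes \<mu>: "is_fa_product P1 P2 \<mu>" and \<nu>: "is_fa_product P1 P2 \<nu>"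
    and A: "A \<in> product_algebra P1 P2"
  shows "\<mu> A = \<nu> A"
proof -
  interpret algebra "space P1 \<times> space P2" "product_algebra P1 P2"
    by (rule algebra_product_algebra)
  have R: "rectangles P1 P2 \<subseteq> product_algebra P1 P2"
    unfolding product_algebra_def by (rule hull_subset)
  obtain C where C: "finite C" "disjoint C" "C \<subseteq> rectangles P1 P2" "A = \<Union>C"
    using product_algebra_decomp[OF A] by metis
  have "\<mu> (\<Union>C) = \<nu> (\<Union>C)"
    using C(1-3)
  proof induction
    case empty
    have "\<mu> ({} \<times> {}) = \<nu> ({} \<times> {})"
      using \<mu> \<nu> unfolding is_fa_product_def by (metis sets.empty_sets)
    then show ?case by simp
  next
    case (insert c C)
    have c: "c \<in> product_algebra P1 P2" and UC: "\<Union>C \<in> product_algebra P1 P2"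
      using insert R by auto
    have dis: "c \<inter> \<Union>C = {}"
      using insert by (auto simp: disjoint_def)
    have "\<mu> c = \<nu> c"
      using insert.prems \<mu> \<nu> by (auto simp: is_fa_product_def rectangles_def)
    moreover have "\<mu> (\<Union>C) = \<nu> (\<Union>C)"
      using insert by (auto simp: disjoint_def)
    ultimately show ?case
      using \<mu> \<nu> c UC dis by (simp add: is_fa_product_def fa_prob_space_def additive_def)
  qed
  with C show ?thesis by simp
qed

lemma is_fa_product_cong:
  assumes "\<And>A. A \<in> product_algebra P1 P2 \<Longrightarrow> \<mu> A = \<nu> A" "is_fa_product P1 P2 \<mu>"
  shows "is_fa_product P1 P2 \<nu>"
proof -
  interpret algebra "space P1 \<times> space P2" "product_algebra P1 P2"
    by (rule algebra_product_algebra)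
  have "A1 \<times> A2 \<in> product_algebra P1 P2" if "A1 \<in> sets P1" "A2 \<in> sets P2" for A1 A2
    using that hull_subset[of "rectangles P1 P2" "algebra (space P1 \<times> space P2)"]
    by (auto simp: product_algebra_def rectangles_def)
  moreover have "\<mu> (A \<union> B) = \<nu> (A \<union> B)"
    if "A \<in> product_algebra P1 P2" "B \<in> product_algebra P1 P2" for A B
    using that assms(1) by blast
  ultimately show ?thesis
    using assms by (auto simp: is_fa_product_def fa_prob_space_def additive_def)
qed

lemma ex1_fa_product:
  assumes "prob_space P1" "prob_space P2"
  shows "\<exists>!\<mu>. is_fa_product P1 P2 \<mu> \<and> (\<forall>A. A \<notin> product_algebra P1 P2 \<longrightarrow> \<mu> A = 0)"
proof (rule ex_ex1I)
  let ?\<mu> = "\<lambda>A. if A \<in> product_algebra P1 P2 then measure (P1 \<Otimes>\<^sub>M P2) A else 0"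
  have "is_fa_product P1 P2 ?\<mu>"
    by (rule is_fa_product_cong[OF _ is_fa_product_pair_measure[OF assms]]) simp
  then show "\<exists>\<mu>. is_fa_product P1 P2 \<mu> \<and> (\<forall>A. A \<notin> product_algebra P1 P2 \<longrightarrow> \<mu> A = 0)"
    by (intro exI[of _ ?\<mu>]) simp
next
  fix \<mu> \<nu>
  assume "is_fa_product P1 P2 \<mu> \<and> (\<forall>A. A \<notin> product_algebra P1 P2 \<longrightarrow> \<mu> A = 0)"
    and "is_fa_product P1 P2 \<nu> \<and> (\<forall>A. A \<notin> product_algebra P1 P2 \<longrightarrow> \<nu> A = 0)"
  then show "\<mu> = \<nu>"
    by (intro ext) (metis is_fa_product_unique)
qed

end

theory Submission
  imports Defs
begin

text \<open>
  The boundary \<open>F\<close> of a continuity set \<open>E\<close> is compact and null. Compactness lets finitely many open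
  rectangles stand in for an open set: between a compact set and an open neighbourhood of it there
  is always an open member of the product algebra (\<open>open_product_algebra_between\<close>). Applied to
  shrinking neighbourhoods of \<open>F\<close>, together with continuity of the product measure from above, this
  gives an open \<open>D \<supseteq> F\<close> in the algebra with measure below \<open>\<epsilon>\<close> (\<open>compact_outer_approximation\<close>).
  Since \<open>D\<close> is open, the part of \<open>closure E\<close> outside \<open>D\<close> is again compact, and it lies in
  \<open>interior E\<close>; a second interpolation yields \<open>A\<close> in the algebra with
  \<open>closure E - D \<subseteq> A \<subseteq> interior E\<close>. Then \<open>A \<subseteq> E \<subseteq> A \<union> D\<close>, and the gap is contained in \<open>D\<close>.
  On the algebra the finitely additive product agrees with the countably additive one, so the
  measure of the gap may be computed with the latter.
\<close>

lemma fa_product_eq_measure: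
  assumes "prob_space P1" "prob_space P2" "A \<in> product_algebra P1 P2"
  shows "fa_product P1 P2 A = measure (P1 \<Otimes>\<^sub>M P2) A"
proof -
  have "is_fa_product P1 P2 (fa_product P1 P2)"
    using theI'[OF ex1_fa_product[OF assms(1,2)]] unfolding fa_product_def by blast
  then show ?thesis
    using is_fa_product_pair_measure[OF assms(1,2)] assms(3) by (rule is_fa_product_unique)
qed

text \<open>
  Every point of \<open>K\<close> has an open rectangle around it inside \<open>U\<close>, and finitely many of these cover
  \<open>K\<close>. Finiteness is what puts their union into the algebra rather than only into the generated
  \<open>\<sigma>\<close>-algebra.
\<close>

lemma open_product_algebra_between:
  fixes P1 :: "'a::topological_space measure" and P2 :: "'b::topological_space measure"
  assumes P1: "sets P1 = sets borel" and P2: "sets P2 = sets borel"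
    and K: "compact K" and U: "open U" "K \<subseteq> U"
  obtains D where "D \<in> product_algebra P1 P2" "open D" "K \<subseteq> D" "D \<subseteq> U"
proof -
  interpret algebra "space P1 \<times> space P2" "product_algebra P1 P2"
    by (rule algebra_product_algebra)
  let ?\<R> = "{A \<times> B | A B. open A \<and> open B \<and> A \<times> B \<subseteq> U}"
  have "K \<subseteq> \<Union>?\<R>"
  proof
    fix z assume "z \<in> K"
    with U(2) have "z \<in> U" by blast
    with U(1) obtain A B where "open A" "open B" "z \<in> A \<times> B" "A \<times> B \<subseteq> U"
      by (rule open_prod_elim)
    then show "z \<in> \<Union>?\<R>" by blast
  qed
  moreover have "\<And>R. R \<in> ?\<R> \<Longrightarrow> open R"
    by (auto intro: open_Times)
  ultimately obtain \<C> where \<C>: "\<C> \<subseteq> ?\<R>" "finite \<C>" "K \<subseteq> \<Union>\<C>"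
    by (rule compactE[OF K])
  have "A \<times> B \<in> rectangles P1 P2" if "open A" "open B" for A B
  proof -
    have "A \<in> sets P1" "B \<in> sets P2"
      using that by (simp_all add: P1 P2)
    then show ?thesis
      unfolding rectangles_def by blast
  qed
  then have "?\<R> \<subseteq> rectangles P1 P2" by auto
  also have "\<dots> \<subseteq> product_algebra P1 P2"
    unfolding product_algebra_def by (rule hull_subset)
  finally have "\<Union>\<C> \<in> product_algebra P1 P2"
    using \<C> by (intro finite_Union) auto
  moreover have "open (\<Union>\<C>)"
    using \<C>(1) by (fast intro: open_Union open_Times)
  moreover have "\<Union>\<C> \<subseteq> U"
    using \<C>(1) by blast
  ultimately show thesis
    using \<C>(3) that by blast
qed

text \<open>
  A compact set is the intersection of its \<open>1/n\<close>-neighbourhoods, hence also of interpolating members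
  of the algebra. A countable intersection of such members is product measurable, and its measure
  is the limit along their finite intersections.
\<close>

lemma compact_outer_approximation:
  fixes P1 :: "'a::metric_space measure" and P2 :: "'b::metric_space measure"
  assumes P1: "prob_space P1" "sets P1 = sets borel" and P2: "prob_space P2" "sets P2 = sets borel"
    and K: "compact K" and "\<epsilon> > 0"
  obtains D where "D \<in> product_algebra P1 P2" "open D" "K \<subseteq> D"
    "measure (P1 \<Otimes>\<^sub>M P2) D < measure (P1 \<Otimes>\<^sub>M P2) K + \<epsilon>"
proof -
  interpret P1: prob_space P1 by fact
  interpret P2: prob_space P2 by fact
  interpret pair_prob_space P1 P2 ..
  interpret algebra "space P1 \<times> space P2" "product_algebra P1 P2"
    by (rule algebra_product_algebra)
  let ?M = "P1 \<Otimes>\<^sub>M P2"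
  define N where "N n = (\<Union>x\<in>K. ball x (1 / real (Suc n)))" for n
  have "\<exists>D. D \<in> product_algebra P1 P2 \<and> open D \<and> K \<subseteq> D \<and> D \<subseteq> N n" for n
  proof -
    have "open (N n)" "K \<subseteq> N n"
      unfolding N_def by auto
    then show ?thesis
      by (rule open_product_algebra_between[OF P1(2) P2(2) K]) blast
  qed
  then obtain D where D: "\<And>n. D n \<in> product_algebra P1 P2" "\<And>n. open (D n)"
      "\<And>n. K \<subseteq> D n" "\<And>n. D n \<subseteq> N n"
    by metis
  \<comment> \<open>The \<open>D n\<close> need not be nested; continuity from above needs their running intersections.\<close>
  define C where "C n = (\<Inter>i\<le>n. D i)" for n
  have C: "C n \<in> product_algebra P1 P2" "open (C n)" "K \<subseteq> C n" for n
    unfolding C_def using D by (auto intro!: finite_INT)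
  have "(\<Inter>n. C n) \<subseteq> K"
  proof
    fix z assume z: "z \<in> (\<Inter>n. C n)"
    show "z \<in> K"
    proof (rule ccontr)
      assume "z \<notin> K"
      with compact_imp_closed[OF K] obtain e where e: "e > 0" "ball z e \<subseteq> - K"
        by (metis ComplI open_Compl open_contains_ball)
      obtain n where n: "1 / real (Suc n) < e"
        using nat_approx_posE[OF e(1)] .
      have "z \<in> N n"
        using z D(4) unfolding C_def by blast
      then obtain x where "x \<in> K" "dist x z < 1 / real (Suc n)"
        unfolding N_def by auto
      with n have "x \<in> ball z e"
        by (simp only: mem_ball dist_commute)
      with \<open>x \<in> K\<close> e(2) show False by blast
    qed
  qed
  with C(3) have Inter: "(\<Inter>n. C n) = K" by blast
  have "range C \<subseteq> sets ?M"
    using C(1) product_algebra_subset_sets by blast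
  moreover have "decseq C"
    unfolding C_def decseq_def by (auto intro: order_trans)
  ultimately have "(\<lambda>n. measure ?M (C n)) \<longlonglongrightarrow> measure ?M K"
    using finite_Lim_measure_decseq[of C] by (simp add: Inter)
  then have "\<forall>\<^sub>F n in sequentially. measure ?M (C n) < measure ?M K + \<epsilon>"
    using \<open>\<epsilon> > 0\<close> by (intro order_tendstoD) auto
  then obtain n where "measure ?M (C n) < measure ?M K + \<epsilon>"
    by (meson eventually_happens' sequentially_bot)
  with C show thesis
    using that by blast
qed

theorem theorem3p5:
  fixes P1 :: "'a::metric_space measure" and P2 :: "'b::metric_space measure"
  assumes "compact (UNIV :: 'a set)" and "compact (UNIV :: 'b set)"
    and "prob_space P1" and "sets P1 = sets borel"
    and "prob_space P2" and "sets P2 = sets borel"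
    and "continuity_set (P1 \<Otimes>\<^sub>M P2) E"
  shows "E \<in> fa_completion (space P1 \<times> space P2) (product_algebra P1 P2) (fa_product P1 P2)"
proof -
  interpret P1: prob_space P1 by fact
  interpret P2: prob_space P2 by fact
  interpret pair_prob_space P1 P2 ..
  interpret algebra "space P1 \<times> space P2" "product_algebra P1 P2"
    by (rule algebra_product_algebra)
  let ?M = "P1 \<Otimes>\<^sub>M P2"
  have E: "E \<in> sets ?M" and null: "measure ?M (frontier E) = 0"
    using assms(7) by (auto simp: continuity_set_def measure_def)
  have compact: "compact S" if "closed S" for S :: "('a \<times> 'b) set"
    using compact_Int_closed[OF compact_Times[OF assms(1,2)] that] by simp
  have "\<exists>A1\<in>product_algebra P1 P2. \<exists>A2\<in>product_algebra P1 P2.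
      A1 \<subseteq> E \<and> E \<subseteq> A2 \<and> fa_product P1 P2 (A2 - A1) < \<epsilon>" if \<epsilon>: "\<epsilon> > 0" for \<epsilon>
  proof -
    obtain D where D: "D \<in> product_algebra P1 P2" "open D" "frontier E \<subseteq> D" "measure ?M D < \<epsilon>"
      by (rule compact_outer_approximation[OF assms(3-6) compact[OF frontier_closed[of E]] \<epsilon>])
        (simp add: null)
    have "compact (closure E - D)"
      using D(2) by (intro compact closed_Diff closed_closure)
    moreover have "closure E - D \<subseteq> interior E"
      using D(3) by (auto simp: frontier_def)
    ultimately obtain A where A: "A \<in> product_algebra P1 P2" "closure E - D \<subseteq> A" "A \<subseteq> interior E"
      by (rule open_product_algebra_between[OF assms(4,6) _ open_interior])
    have "A \<union> D - A \<in> product_algebra P1 P2"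
      using A(1) D(1) by auto
    then have "fa_product P1 P2 (A \<union> D - A) = measure ?M (A \<union> D - A)"
      by (rule fa_product_eq_measure[OF assms(3,5)])
    also have "\<dots> \<le> measure ?M D"
      using D(1) product_algebra_subset_sets by (intro finite_measure_mono) auto
    also note D(4)
    finally have "fa_product P1 P2 (A \<union> D - A) < \<epsilon>" .
    moreover have "A \<subseteq> E" "E \<subseteq> A \<union> D"
      using A closure_subset[of E] interior_subset[of E] by auto
    ultimately show ?thesis
      using A(1) D(1) by blast
  qed
  then show ?thesis
    using sets.sets_into_space[OF E] by (simp add: fa_completion_def space_pair_measure)
qed

end
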